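(* Let $D$ be the feasible set of a decision variable $x$, let $\Xi=\{\xi_1,\dots,\xi_n\}$ be a finite set, and let $h(x,\xi)$ be the objective function. Suppose $N$ independent samples of a random variable $\xi$ with values in $\Xi$ have been observed, with $N_i$ occurrences of $\xi_i$ (so $\sum_{i=1}^n N_i=N$). For a given constant $\gamma$, let $$\mathbb{D}(\gamma)=\Big\{p=(p_1,\dots,p_n)\ \Big|\ \sum_{i=1}^n N_i\log p_i\ge\gamma,\ \sum_{i=1}^n p_i=1,\ p_i\ge 0,\ i=1,\dots,n\Big\},$$ assumed nonempty. If $h(x,\xi)$ is concave in $x$, then the likelihood robust optimization problem $$\text{maximize}_{x\in D}\ \Big\{\min_{p\in\mathbb{D}(\gamma)}\ \sum_{i=1}^n p_i h(x,\xi_i)\Big\}\qquad (\mathrm{LRO})$$ can be solved by solving $$\begin{array}{rl}\text{maximize}_{x,\lambda,\mu} & \mu+\lambda\Big(\gamma+N-\sum_{i=1}^n N_i\log N_i\Big)-N\lambda\log\lambda+\lambda\sum_{i=1}^n N_i\log\big(h(x,\xi_i)-\mu\big)\\[4pt] \text{s.t.} & \lambda\ge 0,\quad h(x,\xi_i)-\mu\ge 0\ \ \forall i,\quad x\in D,\end{array}\qquad (\mathrm{P})$$ which is a convex optimization problem. Furthermore, if $(x^*,\lambda^*,\mu^* )$ is an optimal solution of (P), then $$p_i=\frac{\lambda^* N_i}{h(x^*,\xi_i)-\mu^*}$$ is the corresponding worst-case distribution.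
   Context: The random variable $\xi$ takes values in the set $\Xi$, which is known in advance. $\mathbb{D}(\gamma)$ is called the likelihood robust distribution set with parameter $\gamma$: it contains all distributions $p$ supported in $\Xi$ under which the observed data achieve an empirical likelihood of at least $\exp(\gamma)$. The worst-case distribution corresponding to $x^*$ is the distribution $p\in\mathbb{D}(\gamma)$ attaining the inner minimum of $\sum_{i=1}^n p_i h(x^*,\xi_i)$ in (LRO). The variables $\lambda$ and $\mu$ are the dual variables of the inner minimization problem, associated respectively with the likelihood constraint $\sum_{i=1}^n N_i\log p_i\ge\gamma$ and the constraint $\sum_{i=1}^n p_i=1$.
   Formalization: The worst-case formula is asserted as a whole only when every h(x*,ξ_i)−μ* is nonzero, since it is 0/0 otherwise (e.g. h constant); in general, every worst-case distribution satisfies it at each i with nonzero denominator. D is assumed convex. *)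

theory Defs
  imports "HOL-Analysis.Analysis"
begin

(* Logarithm with log 0 = -infinity; the library's real ln has ln 0 = 0, which would make
   p$i = 0 admissible in the likelihood constraint.  In ereal, 0 * (-infinity) = 0, so the
   usual convention 0 * log 0 = 0 holds in all terms below. *)
definition xlog :: "real \<Rightarrow> ereal" where
  "xlog t = (if 0 < t then ereal (ln t) else - \<infinity>)"

definition log_likelihood :: "('n::finite \<Rightarrow> nat) \<Rightarrow> real ^ 'n \<Rightarrow> ereal" where
  "log_likelihood Nobs p = (\<Sum>i\<in>UNIV. ereal (real (Nobs i)) * xlog (p $ i))"

definition likelihood_robust_set :: "('n::finite \<Rightarrow> nat) \<Rightarrow> real \<Rightarrow> (real ^ 'n) set" where
  "likelihood_robust_set Nobs \<gamma> =
     {p. ereal \<gamma> \<le> log_likelihood Nobs p \<and> (\<Sum>i\<in>UNIV. p $ i) = 1 \<and> (\<forall>i. 0 \<le> p $ i)}"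

definition expected_value ::
  "('a \<Rightarrow> 'b \<Rightarrow> real) \<Rightarrow> ('n::finite \<Rightarrow> 'b) \<Rightarrow> 'a \<Rightarrow> real ^ 'n \<Rightarrow> real" where
  "expected_value h \<xi> x p = (\<Sum>i\<in>UNIV. p $ i * h x (\<xi> i))"

definition worst_case_distribution ::
  "('a \<Rightarrow> 'b \<Rightarrow> real) \<Rightarrow> ('n::finite \<Rightarrow> 'b) \<Rightarrow> ('n \<Rightarrow> nat) \<Rightarrow> real \<Rightarrow> 'a \<Rightarrow> real ^ 'n \<Rightarrow> bool" where
  "worst_case_distribution h \<xi> Nobs \<gamma> x p \<longleftrightarrow>
     is_arg_min (expected_value h \<xi> x) (\<lambda>q. q \<in> likelihood_robust_set Nobs \<gamma>) p"

definition lro_objective ::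
  "('a \<Rightarrow> 'b \<Rightarrow> real) \<Rightarrow> ('n::finite \<Rightarrow> 'b) \<Rightarrow> ('n \<Rightarrow> nat) \<Rightarrow> real \<Rightarrow> 'a \<Rightarrow> real" where
  "lro_objective h \<xi> Nobs \<gamma> x = (INF p\<in>likelihood_robust_set Nobs \<gamma>. expected_value h \<xi> x p)"

definition lro_optimal ::
  "'a set \<Rightarrow> ('a \<Rightarrow> 'b \<Rightarrow> real) \<Rightarrow> ('n::finite \<Rightarrow> 'b) \<Rightarrow> ('n \<Rightarrow> nat) \<Rightarrow> real \<Rightarrow> 'a \<Rightarrow> bool" where
  "lro_optimal D h \<xi> Nobs \<gamma> x \<longleftrightarrow> is_arg_max (lro_objective h \<xi> Nobs \<gamma>) (\<lambda>y. y \<in> D) x"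

definition P_feasible ::
  "'a set \<Rightarrow> ('a \<Rightarrow> 'b \<Rightarrow> real) \<Rightarrow> ('n::finite \<Rightarrow> 'b) \<Rightarrow> ('a \<times> real \<times> real) set" where
  "P_feasible D h \<xi> = {(x, l, m). 0 \<le> l \<and> (\<forall>i. 0 \<le> h x (\<xi> i) - m) \<and> x \<in> D}"

(* l and m are the dual variables lambda and mu.  Only log (h x (xi i) - m) needs the extended logarithm: the real terms N_i log N_i and
   l log l already vanish at 0. *)
fun P_objective ::
  "('a \<Rightarrow> 'b \<Rightarrow> real) \<Rightarrow> ('n::finite \<Rightarrow> 'b) \<Rightarrow> ('n \<Rightarrow> nat) \<Rightarrow> nat \<Rightarrow> real
     \<Rightarrow> 'a \<times> real \<times> real \<Rightarrow> ereal" where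
  "P_objective h \<xi> Nobs N \<gamma> (x, l, m) =
     ereal (m + l * (\<gamma> + real N - (\<Sum>i\<in>UNIV. real (Nobs i) * ln (real (Nobs i))))
            - real N * l * ln l)
     + ereal l * (\<Sum>i\<in>UNIV. ereal (real (Nobs i)) * xlog (h x (\<xi> i) - m))"

definition P_optimal ::
  "'a set \<Rightarrow> ('a \<Rightarrow> 'b \<Rightarrow> real) \<Rightarrow> ('n::finite \<Rightarrow> 'b) \<Rightarrow> ('n \<Rightarrow> nat) \<Rightarrow> nat \<Rightarrow> real
     \<Rightarrow> 'a \<times> real \<times> real \<Rightarrow> bool" where
  "P_optimal D h \<xi> Nobs N \<gamma> z \<longleftrightarrow>
     is_arg_max (P_objective h \<xi> Nobs N \<gamma>) (\<lambda>w. w \<in> P_feasible D h \<xi>) z"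

(* concave_on is real-valued.  The inequality below is the usual one for functions into
   [-infinity, infinity); the objective of the dual problem never takes the value infinity. *)
definition convex_maximization_problem :: "'v::real_vector set \<Rightarrow> ('v \<Rightarrow> ereal) \<Rightarrow> bool" where
  "convex_maximization_problem S f \<longleftrightarrow>
     convex S \<and> (\<forall>z\<in>S. f z \<noteq> \<infinity>) \<and>
     (\<forall>z\<in>S. \<forall>w\<in>S. \<forall>u\<ge>0. \<forall>v\<ge>0. u + v = 1 \<longrightarrow>
        ereal u * f z + ereal v * f w \<le> f (u *\<^sub>R z + v *\<^sub>R w))"

end

(* Weak duality is t >= 1 + ln t with t = p_i (h(x, xi_i) - mu) / (lambda N_i), multiplied by
   lambda N_i and summed over i; its equality case gives the formula for the worst-case
   distribution.  For strong duality, maximising the dual function over lambda leaves a function of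
   mu alone, mu + c * prod_i (h(x, xi_i) - mu)^(N_i/N).  Its stationarity condition at a maximiser
   says that the weights lambda N_i / (h(x, xi_i) - mu) sum to one; at the boundary mu = min h they
   sum to at most one and the remaining mass goes to a minimiser of h.  A maximiser exists if
   gamma is below the maximal log-likelihood; otherwise mu tends to -infinity. *)
theory Submission
  imports Defs "HOL-Real_Asymp.Real_Asymp"
begin

text \<open>For fixed \<open>x\<close> only the numbers \<open>h x (\<xi> i)\<close> matter, so
  duality is proved for an arbitrary real vector \<open>a\<close>; the extended reals are left
  behind by recording where the dual objective is finite. The difficulty is vanishing slacks. At an
  unobserved outcome a slack may vanish while \<lambda> > 0, and then the formula says nothing about
  the mass there. At an observed outcome it leaves the objective finite only for \<lambda> = 0.
  Below the maximal log-likelihood, the maximiser of the function of \<mu> reaches such a point only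
  if all observed values equal min h, because otherwise its slope is infinite there; then the
  empirical distribution is itself a minimiser.\<close>

section \<open>Likelihood sums with log 0 = -\<infinity>\<close>

lemma weighted_xlog_sum:
  fixes w :: "'n::finite \<Rightarrow> nat"
  shows "(\<Sum>i\<in>UNIV. ereal (real (w i)) * xlog (s i)) =
    (if \<forall>i. 0 < w i \<longrightarrow> 0 < s i then ereal (\<Sum>i\<in>UNIV. real (w i) * ln (s i)) else - \<infinity>)"
proof (cases "\<forall>i. 0 < w i \<longrightarrow> 0 < s i")
  case True
  have "ereal (real (w i)) * xlog (s i) = ereal (real (w i) * ln (s i))" for i
    using True by (cases "w i = 0") (auto simp: xlog_def zero_ereal_def[symmetric])
  then show ?thesis using True by simp
next
  case False
  then obtain j where j: "0 < w j" "\<not> 0 < s j" by blast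
  have "ereal (real (w i)) * xlog (s i) \<noteq> \<infinity>" for i
    by (auto simp: xlog_def)
  then have "(\<Sum>i\<in>UNIV - {j}. ereal (real (w i)) * xlog (s i)) \<noteq> \<infinity>"
    by (simp add: sum_Pinfty)
  moreover have "ereal (real (w j)) * xlog (s j) = - \<infinity>"
    using j by (simp add: xlog_def)
  ultimately have "(\<Sum>i\<in>UNIV. ereal (real (w i)) * xlog (s i)) = - \<infinity>"
    by (subst sum.remove[of _ j]) (auto simp: plus_ereal.simps)
  with False show ?thesis by simp
qed

text \<open>With positivity at observed outcomes made explicit, the real \<open>ln\<close> is safe:
  its value \<open>ln 0 = 0\<close> can only occur with weight zero.\<close>

lemma mem_likelihood_robust_set:
  "p \<in> likelihood_robust_set Nobs \<gamma> \<longleftrightarrow>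
     (\<forall>i. 0 < Nobs i \<longrightarrow> 0 < p $ i) \<and> \<gamma> \<le> (\<Sum>i\<in>UNIV. real (Nobs i) * ln (p $ i)) \<and>
     (\<Sum>i\<in>UNIV. p $ i) = 1 \<and> (\<forall>i. 0 \<le> p $ i)"
  by (auto simp: likelihood_robust_set_def log_likelihood_def weighted_xlog_sum)

section \<open>The tangent inequality and weak duality\<close>

text \<open>The left side is l log (s / l), the perspective of the logarithm; the right side is its
  tangent plane along the ray l = s t. The free slope \<open>t\<close> is later chosen as p_i for
  weak duality, as the sample size for the likelihood bound, and as a common slope for
  concavity.\<close>

lemma perspective_log_le:
  fixes l s t :: real
  assumes "0 \<le> l" "0 \<le> s" "0 < l \<Longrightarrow> 0 < s" "0 \<le> t" "0 < l \<Longrightarrow> 0 < t"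
  shows "l * ln s - l * ln l \<le> s * t - l - l * ln t"
proof (cases "l = 0")
  case True
  then show ?thesis using assms by simp
next
  case False
  then have pos: "0 < l" "0 < s" "0 < t" using assms by auto
  then have "ln (s * t / l) \<le> s * t / l - 1" by (intro ln_le_minus_one) simp
  then have "l * ln (s * t / l) \<le> l * (s * t / l - 1)"
    using pos by (intro mult_left_mono) auto
  then show ?thesis using pos by (simp add: ln_div ln_mult algebra_simps)
qed

lemma perspective_log_eq:
  fixes l s t :: real
  assumes "0 < l" "0 < s" "0 < t" "l * ln s - l * ln l = s * t - l - l * ln t"
  shows "s * t = l"
proof -
  have "l * ln (s * t / l) = l * (s * t / l - 1)"
    using assms by (simp add: ln_div ln_mult algebra_simps)
  then have "ln (s * t / l) = s * t / l - 1" using assms by simp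
  then have "s * t / l = 1" using assms by (intro ln_eq_minus_one) auto
  then show ?thesis using assms by simp
qed

definition dual_value :: "('n::finite \<Rightarrow> nat) \<Rightarrow> real \<Rightarrow> ('n \<Rightarrow> real) \<Rightarrow> real \<Rightarrow> real \<Rightarrow> real" where
  "dual_value Nobs \<gamma> a l m =
     m + l * (\<gamma> + (\<Sum>i\<in>UNIV. real (Nobs i)) - (\<Sum>i\<in>UNIV. real (Nobs i) * ln (real (Nobs i))))
       - (\<Sum>i\<in>UNIV. real (Nobs i)) * l * ln l + l * (\<Sum>i\<in>UNIV. real (Nobs i) * ln (a i - m))"

text \<open>This is the effective domain of the dual objective: zero slack is harmless at unobserved
  outcomes, and everywhere when \<open>l = 0\<close>.\<close>

definition dual_finite :: "('n::finite \<Rightarrow> nat) \<Rightarrow> ('n \<Rightarrow> real) \<Rightarrow> real \<Rightarrow> real \<Rightarrow> bool" where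
  "dual_finite Nobs a l m \<longleftrightarrow> 0 \<le> l \<and> (\<forall>i. m \<le> a i) \<and> (\<forall>i. 0 < l \<longrightarrow> 0 < Nobs i \<longrightarrow> m < a i)"

lemma P_objective_eq:
  assumes "(\<Sum>i\<in>UNIV. Nobs i) = N" "(x, l, m) \<in> P_feasible D h \<xi>"
  shows "P_objective h \<xi> Nobs N \<gamma> (x, l, m) =
     (if dual_finite Nobs (\<lambda>i. h x (\<xi> i)) l m
      then ereal (dual_value Nobs \<gamma> (\<lambda>i. h x (\<xi> i)) l m) else - \<infinity>)"
proof -
  have N: "(\<Sum>i\<in>UNIV. real (Nobs i)) = real N" using assms(1) by (metis of_nat_sum)
  have l: "0 \<le> l" "\<And>i. m \<le> h x (\<xi> i)" using assms(2) by (auto simp: P_feasible_def)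
  show ?thesis
  proof (cases "l = 0")
    \<comment> \<open>Here \<open>0 * (- \<infinity>) = 0\<close> keeps the objective finite even if
      an observed slack is zero.\<close>
    case True
    then show ?thesis using l
      by (simp add: dual_finite_def dual_value_def zero_ereal_def[symmetric])
  next
    case False
    then show ?thesis using l
      by (auto simp: dual_finite_def dual_value_def weighted_xlog_sum N)
  qed
qed

text \<open>Summing the perspective inequality with weights \<open>l N\<^sub>i\<close>, slacks \<open>a\<^sub>i - m\<close> and points \<open>p\<^sub>i\<close>.\<close>
lemma dual_value_le_sum:
  assumes "dual_finite Nobs a l m" "p \<in> likelihood_robust_set Nobs \<gamma>"
  shows "dual_value Nobs \<gamma> a l m \<le> (\<Sum>i\<in>UNIV. p $ i * a i)"
    and "dual_value Nobs \<gamma> a l m = (\<Sum>i\<in>UNIV. p $ i * a i) \<Longrightarrow> p $ i * (a i - m) = l * real (Nobs i)"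
proof -
  let ?L = "\<lambda>i. l * real (Nobs i)"
  let ?f = "\<lambda>i. (a i - m) * p $ i - ?L i - ?L i * ln (p $ i) - (?L i * ln (a i - m) - ?L i * ln (?L i))"
  have l: "0 \<le> l" "\<And>i. m \<le> a i" "\<And>i. 0 < l \<Longrightarrow> 0 < Nobs i \<Longrightarrow> m < a i"
    using assms(1) by (auto simp: dual_finite_def)
  have p: "\<And>i. 0 < Nobs i \<Longrightarrow> 0 < p $ i" "\<gamma> \<le> (\<Sum>i\<in>UNIV. real (Nobs i) * ln (p $ i))"
    "(\<Sum>i\<in>UNIV. p $ i) = 1" "\<And>i. 0 \<le> p $ i"
    using assms(2) by (auto simp: mem_likelihood_robust_set)
  have f: "0 \<le> ?f i" for i
    using perspective_log_le[of "?L i" "a i - m" "p $ i"] l p by (auto simp: zero_less_mult_iff)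
  have lnL: "?L i * ln (?L i) = real (Nobs i) * (l * ln l) + l * (real (Nobs i) * ln (real (Nobs i)))" for i
    using l by (cases "l = 0 \<or> Nobs i = 0") (auto simp: ln_mult algebra_simps)
  have "(\<Sum>i\<in>UNIV. ?f i) = (\<Sum>i\<in>UNIV. p $ i * a i - m * p $ i - l * real (Nobs i)
      - l * (real (Nobs i) * ln (p $ i)) - l * (real (Nobs i) * ln (a i - m))
      + (real (Nobs i) * (l * ln l) + l * (real (Nobs i) * ln (real (Nobs i)))))"
    by (intro sum.cong refl) (simp only: lnL, simp add: algebra_simps)
  also have "\<dots> = (\<Sum>i\<in>UNIV. p $ i * a i) - m * 1 - l * (\<Sum>i\<in>UNIV. real (Nobs i))
      - l * (\<Sum>i\<in>UNIV. real (Nobs i) * ln (p $ i)) - l * (\<Sum>i\<in>UNIV. real (Nobs i) * ln (a i - m))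
      + ((\<Sum>i\<in>UNIV. real (Nobs i)) * (l * ln l) + l * (\<Sum>i\<in>UNIV. real (Nobs i) * ln (real (Nobs i))))"
    by (simp only: sum.distrib sum_subtractf sum_distrib_left[symmetric] sum_distrib_right[symmetric] p(3))
  \<comment> \<open>The duality gap is the sum of the tangent gaps plus \<open>l\<close> times the
    excess log-likelihood. Both are nonnegative, so a zero gap makes every \<open>?f i\<close>
    vanish.\<close>
  finally have S: "(\<Sum>i\<in>UNIV. ?f i) + l * ((\<Sum>i\<in>UNIV. real (Nobs i) * ln (p $ i)) - \<gamma>) =
      (\<Sum>i\<in>UNIV. p $ i * a i) - dual_value Nobs \<gamma> a l m"
    by (simp add: dual_value_def algebra_simps)
  have g: "0 \<le> l * ((\<Sum>i\<in>UNIV. real (Nobs i) * ln (p $ i)) - \<gamma>)" using l p by simp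
  have F: "0 \<le> (\<Sum>i\<in>UNIV. ?f i)" by (intro sum_nonneg f)
  show "dual_value Nobs \<gamma> a l m \<le> (\<Sum>i\<in>UNIV. p $ i * a i)" using S g F by linarith
  assume "dual_value Nobs \<gamma> a l m = (\<Sum>i\<in>UNIV. p $ i * a i)"
  then have "(\<Sum>i\<in>UNIV. ?f i) = 0" using S g F by linarith
  then have fi: "?f i = 0" using f by (subst (asm) sum_nonneg_eq_0_iff) auto
  show "p $ i * (a i - m) = l * real (Nobs i)"
  proof (cases "0 < l \<and> 0 < Nobs i")
    case True
    then have "(a i - m) * p $ i = ?L i"
      using fi l p by (intro perspective_log_eq) auto
    then show ?thesis by (simp add: mult.commute)
  next
    \<comment> \<open>When l N_i = 0, \<open>?f i\<close> reduces to
      \<open>(a i - m) * p $ i\<close>, which is complementary slackness.\<close>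
    case False
    then show ?thesis using fi l by auto
  qed
qed

section \<open>The empirical distribution and the case of maximal likelihood\<close>

definition empirical :: "('n::finite \<Rightarrow> nat) \<Rightarrow> real ^ 'n" where
  "empirical Nobs = (\<chi> i. real (Nobs i) / (\<Sum>j\<in>UNIV. real (Nobs j)))"

text \<open>Gibbs' inequality: with tangent slope \<open>t\<close> equal to the sample size, the
  right-hand sides add up to zero because \<open>p\<close> has mass one.\<close>

lemma log_likelihood_le_empirical:
  assumes N: "0 < (\<Sum>i\<in>UNIV. real (Nobs i))" and p: "p \<in> likelihood_robust_set Nobs \<gamma>"
  shows "(\<Sum>i\<in>UNIV. real (Nobs i) * ln (p $ i)) \<le> (\<Sum>i\<in>UNIV. real (Nobs i) * ln (empirical Nobs $ i))"
proof -
  let ?N = "\<Sum>i\<in>UNIV. real (Nobs i)"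
  have "real (Nobs i) * ln (p $ i) - real (Nobs i) * ln (empirical Nobs $ i) \<le> ?N * p $ i - real (Nobs i)" for i
    using perspective_log_le[of "real (Nobs i)" "p $ i" ?N] N p
    by (cases "Nobs i = 0") (auto simp: mem_likelihood_robust_set empirical_def ln_div algebra_simps)
  then have "(\<Sum>i\<in>UNIV. real (Nobs i) * ln (p $ i) - real (Nobs i) * ln (empirical Nobs $ i))
      \<le> (\<Sum>i\<in>UNIV. ?N * p $ i - real (Nobs i))"
    by (intro sum_mono) auto
  also have "\<dots> = 0"
    using p by (simp add: sum_subtractf sum_distrib_left[symmetric] mem_likelihood_robust_set)
  finally show ?thesis by (simp add: sum_subtractf)
qed

lemma empirical_mem:
  assumes N: "0 < (\<Sum>i\<in>UNIV. real (Nobs i))"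
    and "\<gamma> \<le> (\<Sum>i\<in>UNIV. real (Nobs i) * ln (empirical Nobs $ i))"
  shows "empirical Nobs \<in> likelihood_robust_set Nobs \<gamma>"
  using assms by (auto simp: mem_likelihood_robust_set empirical_def sum_divide_distrib[symmetric])

lemma sum_ln_empirical:
  assumes N: "0 < (\<Sum>i\<in>UNIV. real (Nobs i))"
  shows "(\<Sum>i\<in>UNIV. real (Nobs i) * ln (empirical Nobs $ i)) =
    (\<Sum>i\<in>UNIV. real (Nobs i) * ln (real (Nobs i))) - (\<Sum>i\<in>UNIV. real (Nobs i)) * ln (\<Sum>i\<in>UNIV. real (Nobs i))"
proof -
  have "real (Nobs i) * ln (empirical Nobs $ i) =
    real (Nobs i) * ln (real (Nobs i)) - real (Nobs i) * ln (\<Sum>i\<in>UNIV. real (Nobs i))" for i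
    using N by (cases "Nobs i = 0") (auto simp: empirical_def ln_div algebra_simps)
  then show ?thesis by (simp only: sum_subtractf sum_distrib_right)
qed

text \<open>If the empirical distribution is the only robust one, the dual supremum is approached
  only as \<open>m\<close> tends to \<open>-\<infinity>\<close>, along \<open>l = - m / N\<close>.\<close>
lemma dual_value_approaches_empirical:
  fixes a :: "'n::finite \<Rightarrow> real"
  assumes N: "0 < (\<Sum>i\<in>UNIV. real (Nobs i))"
    and g: "\<gamma> = (\<Sum>i\<in>UNIV. real (Nobs i) * ln (empirical Nobs $ i))" and "0 < e"
  shows "\<exists>l m. dual_finite Nobs a l m \<and> (\<Sum>i\<in>UNIV. empirical Nobs $ i * a i) - e < dual_value Nobs \<gamma> a l m"
proof -
  let ?N = "\<Sum>i\<in>UNIV. real (Nobs i)"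
  \<comment> \<open>\<open>?d s\<close> is the dual value at \<open>m = - s\<close>,
    \<open>l = s / ?N\<close>: for the maximal \<open>\<gamma>\<close> all constant terms
    cancel.\<close>
  let ?d = "\<lambda>s. (\<Sum>i\<in>UNIV. real (Nobs i) / ?N * (s * ln (1 + a i / s)))"
  have "((\<lambda>s. s * ln (1 + a i / s)) \<longlongrightarrow> a i) at_top" for i
    by real_asymp
  then have "(?d \<longlongrightarrow> (\<Sum>i\<in>UNIV. real (Nobs i) / ?N * a i)) at_top"
    by (intro tendsto_sum tendsto_mult_left)
  then have "eventually (\<lambda>s. (\<Sum>i\<in>UNIV. real (Nobs i) / ?N * a i) - e < ?d s) at_top"
    by (rule order_tendstoD) (use \<open>0 < e\<close> in simp)
  moreover have "eventually (\<lambda>s. 0 < s \<and> (\<forall>i. - a i < s)) at_top"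
    by (simp add: eventually_conj_iff eventually_all_finite eventually_gt_at_top)
  ultimately have "eventually (\<lambda>s. (\<Sum>i\<in>UNIV. real (Nobs i) / ?N * a i) - e < ?d s \<and> 0 < s \<and> (\<forall>i. - a i < s)) at_top"
    by eventually_elim simp
  then obtain s where s: "(\<Sum>i\<in>UNIV. real (Nobs i) / ?N * a i) - e < ?d s" "0 < s" "\<And>i. - a i < s"
    by (auto dest: eventually_happens)
  have t: "ln (1 + a i / s) = ln (a i + s) - ln s" for i
  proof -
    have "1 + a i / s = (a i + s) / s" using s(2) by (simp add: field_simps)
    moreover have "0 < a i + s" using s(3)[of i] by simp
    ultimately show ?thesis using s(2) by (simp add: ln_div)
  qed
  have "?d s = (\<Sum>i\<in>UNIV. s / ?N * (real (Nobs i) * ln (a i + s)) - s / ?N * ln s * real (Nobs i))"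
    by (intro sum.cong refl) (simp only: t, simp add: algebra_simps diff_divide_distrib)
  also have "\<dots> = s / ?N * (\<Sum>i\<in>UNIV. real (Nobs i) * ln (a i + s)) - s / ?N * ln s * ?N"
    by (simp only: sum_subtractf sum_distrib_left[symmetric])
  also have "\<dots> = dual_value Nobs \<gamma> a (s / ?N) (- s)"
    using N s(2) unfolding dual_value_def g sum_ln_empirical[OF N] by (simp add: ln_div field_simps)
  finally have "?d s = dual_value Nobs \<gamma> a (s / ?N) (- s)" .
  moreover have "dual_finite Nobs a (s / ?N) (- s)"
    unfolding dual_finite_def using N s(2,3) by (auto intro: less_imp_le simp: minus_less_iff)
  ultimately show ?thesis using s(1) by (auto simp: empirical_def)
qed

section \<open>The dual function of \<mu> after maximising over \<lambda>\<close>

text \<open>\<open>dual_value\<close> maximised over \<open>l\<close> is \<open>m + N * dual_scale\<close>. Only the indices with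
  \<open>N\<^sub>i > 0\<close> enter the product because \<open>0 powr 0 = 0\<close>.\<close>
definition dual_scale :: "('n::finite \<Rightarrow> nat) \<Rightarrow> real \<Rightarrow> ('n \<Rightarrow> real) \<Rightarrow> real \<Rightarrow> real" where
  "dual_scale Nobs \<gamma> a m =
     exp ((\<gamma> - (\<Sum>i\<in>UNIV. real (Nobs i) * ln (real (Nobs i)))) / (\<Sum>i\<in>UNIV. real (Nobs i))) *
     (\<Prod>i\<in>{i. 0 < Nobs i}. (a i - m) powr (real (Nobs i) / (\<Sum>j\<in>UNIV. real (Nobs j))))"

lemma dual_scale_nonneg: "0 \<le> dual_scale Nobs \<gamma> a m"
  by (auto simp: dual_scale_def intro!: mult_nonneg_nonneg prod_nonneg)

text \<open>This form suits derivatives and logarithms but holds only for positive observed slacks.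
  The product form stays continuous down to zero slack, where \<open>ln\<close> would return
  0.\<close>

lemma dual_scale_eq_exp:
  assumes "\<And>i. 0 < Nobs i \<Longrightarrow> m < a i"
  shows "dual_scale Nobs \<gamma> a m =
    exp ((\<gamma> - (\<Sum>i\<in>UNIV. real (Nobs i) * ln (real (Nobs i))) + (\<Sum>i\<in>UNIV. real (Nobs i) * ln (a i - m)))
      / (\<Sum>i\<in>UNIV. real (Nobs i)))"
proof -
  let ?N = "\<Sum>i\<in>UNIV. real (Nobs i)"
  have "(\<Prod>i\<in>{i. 0 < Nobs i}. (a i - m) powr (real (Nobs i) / ?N)) =
    (\<Prod>i\<in>{i. 0 < Nobs i}. exp (real (Nobs i) / ?N * ln (a i - m)))"
    using assms by (intro prod.cong) (auto simp: powr_def)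
  also have "\<dots> = exp (\<Sum>i\<in>{i. 0 < Nobs i}. real (Nobs i) / ?N * ln (a i - m))"
    by (simp add: exp_sum)
  also have "(\<Sum>i\<in>{i. 0 < Nobs i}. real (Nobs i) / ?N * ln (a i - m)) =
      (\<Sum>i\<in>UNIV. real (Nobs i) / ?N * ln (a i - m))"
    by (intro sum.mono_neutral_left) auto
  also have "\<dots> = (\<Sum>i\<in>UNIV. real (Nobs i) * ln (a i - m)) / ?N"
    by (simp add: sum_divide_distrib)
  finally show ?thesis
    by (simp add: dual_scale_def exp_add[symmetric] add_divide_distrib)
qed

text \<open>\<open>dual_scale\<close> is the stationary point in \<open>l\<close>: there
  \<open>?N * ln ?l\<close> cancels the rest of the coefficient of \<open>l\<close>, leaving only
  the sample size.\<close>

lemma dual_value_dual_scale: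
  assumes N: "0 < (\<Sum>i\<in>UNIV. real (Nobs i))" and m: "\<And>i. 0 < Nobs i \<Longrightarrow> m < a i"
  shows "dual_value Nobs \<gamma> a (dual_scale Nobs \<gamma> a m) m =
    m + (\<Sum>i\<in>UNIV. real (Nobs i)) * dual_scale Nobs \<gamma> a m"
proof -
  let ?N = "\<Sum>i\<in>UNIV. real (Nobs i)"
  let ?l = "dual_scale Nobs \<gamma> a m"
  have "?N * ln ?l = \<gamma> - (\<Sum>i\<in>UNIV. real (Nobs i) * ln (real (Nobs i))) + (\<Sum>i\<in>UNIV. real (Nobs i) * ln (a i - m))"
    using N by (simp add: dual_scale_eq_exp[OF m])
  then have "?N * ?l * ln ?l = ?l * (\<gamma> - (\<Sum>i\<in>UNIV. real (Nobs i) * ln (real (Nobs i))) + (\<Sum>i\<in>UNIV. real (Nobs i) * ln (a i - m)))"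
    by (simp add: mult.assoc mult.left_commute)
  then show ?thesis by (simp add: dual_value_def algebra_simps)
qed

text \<open>The derivative is one minus the total weight of l N_i / (a_i - m), hence the mass that
  the candidate distribution still lacks.\<close>

lemma dual_scale_has_derivative:
  assumes m: "\<And>i. 0 < Nobs i \<Longrightarrow> m < a i" and N: "0 < (\<Sum>i\<in>UNIV. real (Nobs i))"
  shows "((\<lambda>m. m + (\<Sum>i\<in>UNIV. real (Nobs i)) * dual_scale Nobs \<gamma> a m) has_real_derivative
    1 - dual_scale Nobs \<gamma> a m * (\<Sum>i\<in>UNIV. real (Nobs i) / (a i - m))) (at m)"
proof -
  let ?N = "\<Sum>i\<in>UNIV. real (Nobs i)"
  let ?c = "\<gamma> - (\<Sum>i\<in>UNIV. real (Nobs i) * ln (real (Nobs i)))"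
  let ?E = "\<lambda>m. m + ?N * exp ((?c + (\<Sum>i\<in>UNIV. real (Nobs i) * ln (a i - m))) / ?N)"
  have term_deriv: "((\<lambda>m. real (Nobs i) * ln (a i - m)) has_real_derivative - (real (Nobs i) / (a i - m))) (at m)" for i
  proof (cases "Nobs i = 0")
    case False
    then show ?thesis using m[of i] by (auto intro!: derivative_eq_intros)
  qed simp
  have "((\<lambda>m. \<Sum>i\<in>UNIV. real (Nobs i) * ln (a i - m)) has_real_derivative (\<Sum>i\<in>UNIV. - (real (Nobs i) / (a i - m)))) (at m)"
    by (intro DERIV_sum term_deriv)
  then have S: "((\<lambda>m. \<Sum>i\<in>UNIV. real (Nobs i) * ln (a i - m)) has_real_derivative - (\<Sum>i\<in>UNIV. real (Nobs i) / (a i - m))) (at m)"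
    by (simp only: sum_negf)
  have D: "(?E has_real_derivative
      1 - exp ((?c + (\<Sum>i\<in>UNIV. real (Nobs i) * ln (a i - m))) / ?N) * (\<Sum>i\<in>UNIV. real (Nobs i) / (a i - m))) (at m)"
    by (rule DERIV_cong, rule DERIV_add[OF DERIV_ident DERIV_cmult[OF DERIV_fun_exp[OF DERIV_cdivide[OF DERIV_add[OF DERIV_const S]]]]])
      (use N in simp)
  have "eventually (\<lambda>y. 0 < Nobs i \<longrightarrow> y < a i) (nhds m)" for i
  proof (cases "Nobs i = 0")
    case False
    then have "eventually (\<lambda>y. y \<in> {..<a i}) (nhds m)"
      using m[of i] by (intro eventually_nhds_in_open) auto
    then show ?thesis by eventually_elim simp
  qed simp
  then have "eventually (\<lambda>y. \<forall>i. 0 < Nobs i \<longrightarrow> y < a i) (nhds m)"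
    by (rule eventually_all_finite)
  then have "eventually (\<lambda>y. y + ?N * dual_scale Nobs \<gamma> a y = ?E y) (nhds m)"
    by eventually_elim (simp add: dual_scale_eq_exp)
  from DERIV_cong_ev[OF refl this refl] D show ?thesis
    by (simp add: dual_scale_eq_exp[OF m])
qed

text \<open>Changing \<open>\<gamma>\<close> only rescales \<open>dual_scale\<close>. Raising it to
  the maximal log-likelihood costs the factor \<open>\<rho>\<close>, and there weak duality against
  the empirical distribution gives the bound.\<close>

lemma dual_scale_upper_bound:
  assumes N: "0 < (\<Sum>i\<in>UNIV. real (Nobs i))" and m: "\<And>i. m < a i"
    and slater: "\<gamma> < (\<Sum>i\<in>UNIV. real (Nobs i) * ln (empirical Nobs $ i))"
  defines "\<rho> \<equiv> exp ((\<gamma> - (\<Sum>i\<in>UNIV. real (Nobs i) * ln (empirical Nobs $ i))) / (\<Sum>i\<in>UNIV. real (Nobs i)))"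
  shows "m + (\<Sum>i\<in>UNIV. real (Nobs i)) * dual_scale Nobs \<gamma> a m \<le>
    m + \<rho> * ((\<Sum>i\<in>UNIV. empirical Nobs $ i * a i) - m)"
proof -
  let ?N = "\<Sum>i\<in>UNIV. real (Nobs i)"
  let ?g = "\<Sum>i\<in>UNIV. real (Nobs i) * ln (empirical Nobs $ i)"
  have "dual_scale Nobs \<gamma> a m = \<rho> * dual_scale Nobs ?g a m"
    by (simp add: dual_scale_def \<rho>_def exp_add[symmetric] mult.assoc[symmetric] add_divide_distrib[symmetric] diff_divide_distrib[symmetric])
  moreover have "m + ?N * dual_scale Nobs ?g a m \<le> (\<Sum>i\<in>UNIV. empirical Nobs $ i * a i)"
    using dual_value_le_sum(1)[of Nobs a "dual_scale Nobs ?g a m" m "empirical Nobs" ?g] m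
    by (auto simp: dual_value_dual_scale[OF N] dual_finite_def dual_scale_nonneg empirical_mem[OF N] less_imp_le)
  then have "\<rho> * (?N * dual_scale Nobs ?g a m) \<le> \<rho> * ((\<Sum>i\<in>UNIV. empirical Nobs $ i * a i) - m)"
    by (intro mult_left_mono) (auto simp: \<rho>_def)
  ultimately show ?thesis by (simp add: mult.left_commute)
qed

text \<open>The factor \<open>\<rho> < 1\<close> of the previous bound makes the profile tend to \<open>-\<infinity>\<close>
  with \<open>m\<close>, so its maximum is attained.\<close>
lemma dual_profile_attains_max:
  fixes a :: "'n::finite \<Rightarrow> real"
  assumes N: "0 < (\<Sum>i\<in>UNIV. real (Nobs i))"
    and slater: "\<gamma> < (\<Sum>i\<in>UNIV. real (Nobs i) * ln (empirical Nobs $ i))"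
    and b: "\<And>i. b \<le> a i"
  shows "\<exists>m\<le>b. \<forall>y\<le>b. y + (\<Sum>i\<in>UNIV. real (Nobs i)) * dual_scale Nobs \<gamma> a y
    \<le> m + (\<Sum>i\<in>UNIV. real (Nobs i)) * dual_scale Nobs \<gamma> a m"
proof -
  let ?N = "\<Sum>i\<in>UNIV. real (Nobs i)"
  let ?f = "\<lambda>y. y + ?N * dual_scale Nobs \<gamma> a y"
  define \<rho> where "\<rho> = exp ((\<gamma> - (\<Sum>i\<in>UNIV. real (Nobs i) * ln (empirical Nobs $ i))) / ?N)"
  define E where "E = (\<Sum>i\<in>UNIV. empirical Nobs $ i * a i)"
  have \<rho>: "\<rho> < 1" using N slater by (simp add: \<rho>_def divide_neg_pos)
  \<comment> \<open>Below \<open>M\<close> the bound \<open>y + \<rho> * (E - y)\<close> is at most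
    \<open>b\<close>, hence at most the profile at \<open>b\<close>; only the compact interval
    remains.\<close>
  define M where "M = min b ((b - \<rho> * E) / (1 - \<rho>))"
  have powr: "continuous_on {M..b} (\<lambda>y. (a i - y) powr (real (Nobs i) / ?N))" if "0 < Nobs i" for i
  proof (rule continuous_on_powr')
    show "\<forall>y\<in>{M..b}. 0 \<le> a i - y \<and> (a i - y = 0 \<longrightarrow> 0 < real (Nobs i) / ?N)"
      using b[of i] N that by (auto intro!: divide_pos_pos)
  qed (intro continuous_on_const continuous_on_diff continuous_on_id)+
  have "continuous_on {M..b} ?f"
    unfolding dual_scale_def
    by (intro continuous_on_const continuous_on_id continuous_on_add continuous_on_mult continuous_on_prod)
      (use powr in simp)
  moreover have "{M..b} \<noteq> {}" by (simp add: M_def)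
  ultimately obtain m where m: "m \<in> {M..b}" "\<And>y. y \<in> {M..b} \<Longrightarrow> ?f y \<le> ?f m"
    using continuous_attains_sup[of "{M..b}" ?f] by auto
  have "?f y \<le> ?f m" if "y \<le> b" for y
  proof (cases "M \<le> y")
    case True
    then show ?thesis using m(2) that by simp
  next
    case False
    then have y: "y < b" "y < (b - \<rho> * E) / (1 - \<rho>)" by (auto simp: M_def)
    have "?f y \<le> y + \<rho> * (E - y)"
      unfolding \<rho>_def E_def using y(1) b by (intro dual_scale_upper_bound[OF N _ slater]) (meson less_le_trans)
    also have "\<dots> \<le> b" using y(2) \<rho> by (simp add: field_simps)
    also have "\<dots> \<le> ?f b" using N by (simp add: dual_scale_nonneg)
    also have "\<dots> \<le> ?f m" using m(2)[of b] by (simp add: M_def)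
    finally show ?thesis .
  qed
  then show ?thesis using m(1) by auto
qed

section \<open>Attainment and strong duality\<close>

text \<open>A profile maximiser \<open>m\<close> yields a primal point with zero gap. If all
  observed slacks are positive, its first-order conditions supply the point; otherwise
  \<open>l = 0\<close> and the empirical distribution do.\<close>

lemma dual_attained:
  fixes a :: "'n::finite \<Rightarrow> real"
  assumes N: "0 < (\<Sum>i\<in>UNIV. real (Nobs i))"
    and slater: "\<gamma> < (\<Sum>i\<in>UNIV. real (Nobs i) * ln (empirical Nobs $ i))"
  shows "\<exists>l m. \<exists>p\<in>likelihood_robust_set Nobs \<gamma>. dual_finite Nobs a l m \<and>
    dual_value Nobs \<gamma> a l m = (\<Sum>i\<in>UNIV. p $ i * a i)"
proof -
  let ?N = "\<Sum>i\<in>UNIV. real (Nobs i)"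
  let ?f = "\<lambda>y. y + ?N * dual_scale Nobs \<gamma> a y"
  define b where "b = Min (range a)"
  have b: "b \<le> a i" for i by (simp add: b_def)
  have "b \<in> range a" unfolding b_def by (intro Min_in) auto
  then obtain j where j: "a j = b" by auto
  obtain m where m: "m \<le> b" and max: "\<And>y. y \<le> b \<Longrightarrow> ?f y \<le> ?f m"
    using dual_profile_attains_max[where a = a and b = b, OF N slater b] by auto
  show ?thesis
  proof (cases "\<forall>i. 0 < Nobs i \<longrightarrow> m < a i")
    case True
    then have Nm: "\<And>i. 0 < Nobs i \<Longrightarrow> m < a i" by blast
    let ?l = "dual_scale Nobs \<gamma> a m"
    let ?q = "\<lambda>i. ?l * real (Nobs i) / (a i - m)"
    have l: "0 < ?l" by (simp add: dual_scale_eq_exp[OF Nm])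
    let ?D = "1 - ?l * (\<Sum>i\<in>UNIV. real (Nobs i) / (a i - m))"
    have D: "(?f has_real_derivative ?D) (at m)"
      by (rule dual_scale_has_derivative[OF Nm N])
    have Dq: "?D = 1 - (\<Sum>i\<in>UNIV. ?q i)" by (simp add: sum_distrib_left)
    \<comment> \<open>Moving left from \<open>m\<close> is always allowed, moving right only when
      \<open>m < b\<close>; hence one sign here and equality only off the boundary.\<close>
    have D0: "0 \<le> ?D"
    proof (rule ccontr)
      assume "\<not> 0 \<le> ?D"
      then obtain d where "0 < d" "\<And>h. 0 < h \<Longrightarrow> h < d \<Longrightarrow> ?f m < ?f (m - h)"
        using DERIV_neg_dec_left[OF D] by fastforce
      from this(2)[of "d / 2"] \<open>0 < d\<close> show False using max[of "m - d / 2"] m by simp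
    qed
    have D1: "?D \<le> 0" if "m < b"
    proof (rule ccontr)
      assume "\<not> ?D \<le> 0"
      then obtain d where d: "0 < d" "\<And>h. 0 < h \<Longrightarrow> h < d \<Longrightarrow> ?f m < ?f (m + h)"
        using DERIV_pos_inc_right[OF D] by fastforce
      let ?h = "min (d / 2) (b - m)"
      have "?f m < ?f (m + ?h)" using d(1) that by (intro d(2)) (auto simp: min_less_iff_disj)
      moreover have "?f (m + ?h) \<le> ?f m" by (rule max) auto
      ultimately show False by simp
    qed
    define r where "r = ?D"
    have q: "0 \<le> ?q i" for i using l b[of i] m by simp
    have qpos: "0 < ?q i" if "0 < Nobs i" for i using l Nm[OF that] that by simp
    have r: "0 \<le> r" "r = 0 \<or> a j = m" using D0 D1 m j by (auto simp: r_def)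
    \<comment> \<open>The lacking mass \<open>r\<close> can be nonzero only if the slack at
      \<open>j\<close> is zero, so it leaves every product \<open>p $ i * (a i - m)\<close>
      unchanged.\<close>
    define p :: "real ^ 'n" where "p = (\<chi> i. ?q i + (if i = j then r else 0))"
    have pq: "?q i \<le> p $ i" for i using r by (simp add: p_def)
    have p1: "(\<Sum>i\<in>UNIV. p $ i) = 1"
      using Dq by (simp add: p_def sum.distrib r_def)
    have pa: "p $ i * (a i - m) = ?l * real (Nobs i)" for i
      using r(2) Nm[of i] by (cases "Nobs i = 0") (auto simp: p_def distrib_right)
    have "(\<Sum>i\<in>UNIV. p $ i * (a i - m)) = ?N * ?l" by (simp only: pa sum_distrib_left[symmetric]) (rule mult.commute)
    moreover have "(\<Sum>i\<in>UNIV. p $ i * (a i - m)) = (\<Sum>i\<in>UNIV. p $ i * a i) - (\<Sum>i\<in>UNIV. p $ i) * m"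
      by (simp add: right_diff_distrib sum_subtractf sum_distrib_right)
    ultimately have val: "dual_value Nobs \<gamma> a ?l m = (\<Sum>i\<in>UNIV. p $ i * a i)"
      by (simp add: dual_value_dual_scale[OF N Nm] p1)
    \<comment> \<open>The value of \<open>dual_scale\<close> makes \<open>?q\<close> meet the
      likelihood bound with equality; the added mass can only raise it.\<close>
    have "real (Nobs i) * ln (?q i) = ln ?l * real (Nobs i) + real (Nobs i) * ln (real (Nobs i)) - real (Nobs i) * ln (a i - m)" for i
      using l Nm[of i] by (cases "Nobs i = 0") (auto simp: ln_div ln_mult algebra_simps)
    then have "(\<Sum>i\<in>UNIV. real (Nobs i) * ln (?q i)) = ln ?l * ?N + (\<Sum>i\<in>UNIV. real (Nobs i) * ln (real (Nobs i)))
      - (\<Sum>i\<in>UNIV. real (Nobs i) * ln (a i - m))"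
      by (simp only: sum.distrib sum_subtractf sum_distrib_left)
    also have "\<dots> = \<gamma>" using N by (simp add: dual_scale_eq_exp[OF Nm])
    finally have "\<gamma> = (\<Sum>i\<in>UNIV. real (Nobs i) * ln (?q i))" by simp
    also have "\<dots> \<le> (\<Sum>i\<in>UNIV. real (Nobs i) * ln (p $ i))"
    proof (intro sum_mono)
      show "real (Nobs i) * ln (?q i) \<le> real (Nobs i) * ln (p $ i)" for i
        using qpos[of i] pq[of i] by (cases "Nobs i = 0") (auto intro!: mult_left_mono ln_mono)
    qed
    finally have "p \<in> likelihood_robust_set Nobs \<gamma>"
      using p1 pq q qpos by (auto simp: mem_likelihood_robust_set intro: order_trans less_le_trans)
    moreover have "dual_finite Nobs a ?l m"
      using l Nm b m by (auto simp: dual_finite_def intro: order_trans)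
    ultimately show ?thesis using val by blast
  next
    case False
    then obtain k where k: "0 < Nobs k" "a k \<le> m" by auto
    then have mb: "m = b" using b[of k] m by simp
    then have ak: "a k = b" using b[of k] k by simp
    have "dual_scale Nobs \<gamma> a b = 0"
      using k ak by (auto simp: dual_scale_def)
    then have max': "?N * dual_scale Nobs \<gamma> a (b - t) \<le> t" if "0 < t" for t
      using max[of "b - t"] that mb by simp
    text \<open>Near \<open>b\<close> the profile has infinite slope unless every observed \<open>a\<^sub>i\<close> equals \<open>b\<close>.\<close>
    have ab: "a i = b" if i: "0 < Nobs i" for i
    proof (rule ccontr)
      assume "a i \<noteq> b"
      then have d: "0 < a i - b" using b[of i] by simp
      let ?c = "\<gamma> - (\<Sum>i\<in>UNIV. real (Nobs i) * ln (real (Nobs i)))"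
      \<comment> \<open>\<open>?C\<close> exceeds \<open>- ?c - ?N * ln ?N\<close>, the most that
        maximality at \<open>b\<close> permits, and \<open>t\<close> is chosen so that ln ((a_i - b)
        / t) equals \<open>?C\<close>.\<close>
      let ?C = "\<bar>?c + ?N * ln ?N\<bar> + 1"
      define t where "t = (a i - b) / exp ?C"
      have t: "0 < t" using d by (simp add: t_def)
      have pos: "0 < a i - (b - t)" for i using b[of i] t by simp
      have "dual_scale Nobs \<gamma> a (b - t) \<le> t / ?N"
        using max'[OF t] N by (simp add: pos_le_divide_eq mult.commute)
      then have "ln (dual_scale Nobs \<gamma> a (b - t)) \<le> ln (t / ?N)"
        using pos t N by (subst ln_le_cancel_iff) (auto simp: dual_scale_eq_exp)
      then have "?c + (\<Sum>i\<in>UNIV. real (Nobs i) * ln (a i - (b - t))) \<le> ?N * ln t - ?N * ln ?N"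
        using pos t N by (simp add: dual_scale_eq_exp ln_div field_simps)
      then have "(\<Sum>i\<in>UNIV. real (Nobs i) * ln (a i - (b - t)) - real (Nobs i) * ln t) \<le> - ?c - ?N * ln ?N"
        by (simp add: sum_subtractf sum_distrib_right)
      moreover have "0 \<le> real (Nobs i) * ln (a i - (b - t)) - real (Nobs i) * ln t" for i
        using b[of i] t pos[of i] by (auto simp: right_diff_distrib[symmetric] intro!: mult_nonneg_nonneg)
      then have "real (Nobs i) * ln (a i - (b - t)) - real (Nobs i) * ln t
          \<le> (\<Sum>i\<in>UNIV. real (Nobs i) * ln (a i - (b - t)) - real (Nobs i) * ln t)"
        by (intro member_le_sum) auto
      moreover have "?C \<le> real (Nobs i) * ln (a i - (b - t)) - real (Nobs i) * ln t"
      proof -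
        have "ln (a i - b) \<le> ln (a i - (b - t))" using d t by (subst ln_le_cancel_iff) auto
        moreover have "ln t = ln (a i - b) - ?C" using d by (simp add: t_def ln_div)
        ultimately have "?C \<le> ln (a i - (b - t)) - ln t" by linarith
        moreover have "1 \<le> real (Nobs i)" using i by simp
        ultimately have "1 * ?C \<le> real (Nobs i) * (ln (a i - (b - t)) - ln t)"
          by (intro mult_mono) auto
        then show ?thesis by (simp add: right_diff_distrib)
      qed
      ultimately show False by linarith
    qed
    have e: "empirical Nobs $ i * a i = empirical Nobs $ i * b" for i
      using ab[of i] by (cases "Nobs i = 0") (auto simp: empirical_def)
    have mem: "empirical Nobs \<in> likelihood_robust_set Nobs \<gamma>"
      using slater by (intro empirical_mem[OF N]) simp
    have "(\<Sum>i\<in>UNIV. empirical Nobs $ i * a i) = (\<Sum>i\<in>UNIV. empirical Nobs $ i) * b"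
      by (simp only: e sum_distrib_right)
    then have "(\<Sum>i\<in>UNIV. empirical Nobs $ i * a i) = b"
      using mem by (simp add: mem_likelihood_robust_set)
    then have "dual_value Nobs \<gamma> a 0 b = (\<Sum>i\<in>UNIV. empirical Nobs $ i * a i)"
      by (simp add: dual_value_def)
    moreover have "dual_finite Nobs a 0 b" using b by (simp add: dual_finite_def)
    ultimately show ?thesis using mem by blast
  qed
qed

text \<open>Without data the robust set is the whole simplex, so a point mass at a minimiser of
  \<open>a\<close> matches the dual value at \<open>l = 0\<close>.\<close>

lemma dual_attained_no_observations:
  fixes a :: "'n::finite \<Rightarrow> real"
  assumes "\<And>i. Nobs i = 0" "\<gamma> \<le> 0"
  shows "\<exists>l m. \<exists>p\<in>likelihood_robust_set Nobs \<gamma>. dual_finite Nobs a l m \<and>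
    dual_value Nobs \<gamma> a l m = (\<Sum>i\<in>UNIV. p $ i * a i)"
proof -
  define b where "b = Min (range a)"
  have b: "b \<le> a i" for i by (simp add: b_def)
  have "b \<in> range a" unfolding b_def by (intro Min_in) auto
  then obtain j where j: "a j = b" by auto
  have "axis j 1 $ i * a i = (if i = j then b else 0)" for i
    using j by (auto simp: axis_def)
  then have "dual_value Nobs \<gamma> a 0 b = (\<Sum>i\<in>UNIV. axis j 1 $ i * a i)"
    by (simp add: dual_value_def)
  moreover have "axis j 1 \<in> likelihood_robust_set Nobs \<gamma>"
    using assms by (auto simp: mem_likelihood_robust_set axis_def)
  moreover have "dual_finite Nobs a 0 b" using b by (simp add: dual_finite_def)
  ultimately show ?thesis by blast
qed

lemma dual_attained_slater:
  fixes a :: "'n::finite \<Rightarrow> real"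
  assumes p: "p \<in> likelihood_robust_set Nobs \<gamma>" and slater: "ereal \<gamma> < log_likelihood Nobs p"
  shows "\<exists>l m. \<exists>p\<in>likelihood_robust_set Nobs \<gamma>. dual_finite Nobs a l m \<and>
    dual_value Nobs \<gamma> a l m = (\<Sum>i\<in>UNIV. p $ i * a i)"
proof (cases "\<forall>i. Nobs i = 0")
  case True
  then show ?thesis using p
    by (intro dual_attained_no_observations) (auto simp: mem_likelihood_robust_set)
next
  case False
  then obtain i where "0 < real (Nobs i)" by auto
  then have N: "0 < (\<Sum>i\<in>UNIV. real (Nobs i))" by (intro sum_pos2[of _ i]) auto
  have "\<gamma> < (\<Sum>i\<in>UNIV. real (Nobs i) * ln (p $ i))"
    using slater p by (auto simp: log_likelihood_def weighted_xlog_sum mem_likelihood_robust_set split: if_splits)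
  also have "\<dots> \<le> (\<Sum>i\<in>UNIV. real (Nobs i) * ln (empirical Nobs $ i))"
    by (rule log_likelihood_le_empirical[OF N p])
  finally show ?thesis by (rule dual_attained[OF N])
qed

text \<open>One \<open>p\<close> serves every \<open>e\<close>, which makes it a minimiser; the
  multipliers may vary with \<open>e\<close>, since at maximal likelihood the dual supremum need not
  be attained.\<close>

lemma strong_duality:
  fixes a :: "'n::finite \<Rightarrow> real"
  assumes "likelihood_robust_set Nobs \<gamma> \<noteq> {}"
  shows "\<exists>p\<in>likelihood_robust_set Nobs \<gamma>. \<forall>e>0. \<exists>l m. dual_finite Nobs a l m \<and>
    (\<Sum>i\<in>UNIV. p $ i * a i) - e < dual_value Nobs \<gamma> a l m"
proof (cases "(\<forall>i. Nobs i = 0) \<or> \<gamma> < (\<Sum>i\<in>UNIV. real (Nobs i) * ln (empirical Nobs $ i))")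
  case True
  have "\<exists>l m. \<exists>p\<in>likelihood_robust_set Nobs \<gamma>. dual_finite Nobs a l m \<and>
    dual_value Nobs \<gamma> a l m = (\<Sum>i\<in>UNIV. p $ i * a i)"
  proof (cases "\<forall>i. Nobs i = 0")
    case True
    then show ?thesis using assms
      by (intro dual_attained_no_observations) (auto simp: mem_likelihood_robust_set ex_in_conv[symmetric])
  next
    case False
    then obtain i where "0 < real (Nobs i)" by auto
    then have N: "0 < (\<Sum>i\<in>UNIV. real (Nobs i))" by (intro sum_pos2[of _ i]) auto
    with False True show ?thesis by (intro dual_attained) auto
  qed
  then obtain l m p where "p \<in> likelihood_robust_set Nobs \<gamma>" "dual_finite Nobs a l m"
    "dual_value Nobs \<gamma> a l m = (\<Sum>i\<in>UNIV. p $ i * a i)" by blast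
  then show ?thesis by (intro bexI[of _ p] allI impI exI[of _ l] exI[of _ m]) auto
next
  case False
  then obtain i where "0 < real (Nobs i)" by auto
  then have N: "0 < (\<Sum>i\<in>UNIV. real (Nobs i))" by (intro sum_pos2[of _ i]) auto
  obtain p where p: "p \<in> likelihood_robust_set Nobs \<gamma>" using assms by blast
  \<comment> \<open>Nonemptiness bounds \<open>\<gamma>\<close> by the maximal log-likelihood, so
    failure of the strict inequality means equality.\<close>
  have g: "\<gamma> = (\<Sum>i\<in>UNIV. real (Nobs i) * ln (empirical Nobs $ i))"
    using False p log_likelihood_le_empirical[OF N p] by (auto simp: mem_likelihood_robust_set)
  show ?thesis
    using dual_value_approaches_empirical[OF N g]
    by (intro bexI[of _ "empirical Nobs"] empirical_mem[OF N]) (auto simp: g[symmetric])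
qed

section \<open>Joint concavity of the dual objective\<close>

text \<open>A common tangent slope \<open>t = L / S\<close> at the mixed point bounds both perspective terms.\<close>
lemma perspective_log_concave:
  fixes l1 l2 s1 s2 u v s :: real
  assumes nn: "0 \<le> l1" "0 \<le> l2" "0 \<le> s1" "0 \<le> s2" "0 < u" "0 < v"
    and pos: "0 < l1 \<Longrightarrow> 0 < s1" "0 < l2 \<Longrightarrow> 0 < s2" and s: "u * s1 + v * s2 \<le> s"
  shows "u * (l1 * ln s1 - l1 * ln l1) + v * (l2 * ln s2 - l2 * ln l2) \<le>
    (u * l1 + v * l2) * ln s - (u * l1 + v * l2) * ln (u * l1 + v * l2)"
proof (cases "l1 = 0 \<and> l2 = 0")
  case False
  define L where "L = u * l1 + v * l2"
  define S where "S = u * s1 + v * s2"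
  have l: "0 < l1 \<or> 0 < l2" using False nn by auto
  then have L: "0 < L"
    using nn by (auto simp: L_def intro: add_pos_nonneg add_nonneg_pos)
  have "0 < s1 \<or> 0 < s2" using l pos by auto
  then have S: "0 < S"
    using nn by (auto simp: S_def intro: add_pos_nonneg add_nonneg_pos)
  let ?t = "L / S"
  have t: "0 < ?t" using L S by simp
  have "u * (l1 * ln s1 - l1 * ln l1) \<le> u * (s1 * ?t - l1 - l1 * ln ?t)"
    using nn pos t by (intro mult_left_mono perspective_log_le) auto
  moreover have "v * (l2 * ln s2 - l2 * ln l2) \<le> v * (s2 * ?t - l2 - l2 * ln ?t)"
    using nn pos t by (intro mult_left_mono perspective_log_le) auto
  moreover have "u * (s1 * ?t - l1 - l1 * ln ?t) + v * (s2 * ?t - l2 - l2 * ln ?t) = S * ?t - L - L * ln ?t"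
    unfolding L_def S_def by (simp only: algebra_simps)
  moreover have "S * ?t - L - L * ln ?t = L * ln S - L * ln L"
    using S L by (simp add: ln_div algebra_simps)
  moreover have "L * ln S \<le> L * ln s" using L S s by (auto simp: S_def)
  ultimately show ?thesis unfolding L_def by linarith
qed auto

text \<open>Up to terms affine in (l, m), the dual value is the sum of N_i l log ((a_i - m) / l).
  Each perspective is jointly concave and increasing in \<open>a\<close>, so it suffices that
  \<open>a\<close> dominates the mixture, as concavity of \<open>h\<close> provides.\<close>

lemma dual_value_concave:
  assumes f1: "dual_finite Nobs a1 l1 m1" and f2: "dual_finite Nobs a2 l2 m2"
    and uv: "0 < u" "0 < v" and a: "\<And>i. u * a1 i + v * a2 i \<le> a i"
  shows "dual_finite Nobs a (u * l1 + v * l2) (u * m1 + v * m2)"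
    and "u * dual_value Nobs \<gamma> a1 l1 m1 + v * dual_value Nobs \<gamma> a2 l2 m2
      \<le> dual_value Nobs \<gamma> a (u * l1 + v * l2) (u * m1 + v * m2)"
proof -
  let ?l = "u * l1 + v * l2" and ?m = "u * m1 + v * m2"
  have nn: "0 \<le> l1" "0 \<le> l2" "\<And>i. m1 \<le> a1 i" "\<And>i. m2 \<le> a2 i"
    and pos: "\<And>i. 0 < l1 \<Longrightarrow> 0 < Nobs i \<Longrightarrow> m1 < a1 i" "\<And>i. 0 < l2 \<Longrightarrow> 0 < Nobs i \<Longrightarrow> m2 < a2 i"
    using f1 f2 by (auto simp: dual_finite_def)
  have s: "u * (a1 i - m1) + v * (a2 i - m2) \<le> a i - ?m" for i
    using a[of i] by (simp add: algebra_simps)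
  have s0: "0 \<le> u * (a1 i - m1)" "0 \<le> v * (a2 i - m2)" for i using nn uv by auto
  have "0 < a i - ?m" if "0 < ?l" "0 < Nobs i" for i
  proof -
    have "0 < l1 \<or> 0 < l2" using that(1) nn by (auto simp: less_le)
    then have "0 < u * (a1 i - m1) \<or> 0 < v * (a2 i - m2)" using pos that(2) uv by auto
    then show ?thesis using s[of i] s0[of i] by linarith
  qed
  moreover have "0 \<le> a i - ?m" for i using s[of i] s0[of i] by linarith
  moreover have "0 \<le> ?l" using nn uv by simp
  ultimately show "dual_finite Nobs a ?l ?m" unfolding dual_finite_def by (metis diff_ge_0_iff_ge diff_gt_0_iff_gt)
  have dv: "dual_value Nobs \<gamma> a l m =
      m + l * (\<gamma> + (\<Sum>i\<in>UNIV. real (Nobs i)) - (\<Sum>i\<in>UNIV. real (Nobs i) * ln (real (Nobs i))))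
      + (\<Sum>i\<in>UNIV. real (Nobs i) * (l * ln (a i - m) - l * ln l))" for a l m
    by (simp add: dual_value_def right_diff_distrib sum_subtractf sum_distrib_left sum_distrib_right algebra_simps)
  have "real (Nobs i) * (u * (l1 * ln (a1 i - m1) - l1 * ln l1) + v * (l2 * ln (a2 i - m2) - l2 * ln l2))
      \<le> real (Nobs i) * (?l * ln (a i - ?m) - ?l * ln ?l)" for i
  proof (cases "Nobs i = 0")
    case False
    then show ?thesis
      using nn pos[of i] uv s[of i] by (intro mult_left_mono perspective_log_concave) auto
  qed simp
  then have "(\<Sum>i\<in>UNIV. real (Nobs i) * (u * (l1 * ln (a1 i - m1) - l1 * ln l1) + v * (l2 * ln (a2 i - m2) - l2 * ln l2)))
      \<le> (\<Sum>i\<in>UNIV. real (Nobs i) * (?l * ln (a i - ?m) - ?l * ln ?l))"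
    by (rule sum_mono)
  moreover have "(\<Sum>i\<in>UNIV. real (Nobs i) * (u * (l1 * ln (a1 i - m1) - l1 * ln l1) + v * (l2 * ln (a2 i - m2) - l2 * ln l2)))
    = u * (\<Sum>i\<in>UNIV. real (Nobs i) * (l1 * ln (a1 i - m1) - l1 * ln l1))
      + v * (\<Sum>i\<in>UNIV. real (Nobs i) * (l2 * ln (a2 i - m2) - l2 * ln l2))"
    by (simp only: sum_distrib_left sum.distrib[symmetric]) (intro sum.cong refl, simp add: algebra_simps)
  ultimately show "u * dual_value Nobs \<gamma> a1 l1 m1 + v * dual_value Nobs \<gamma> a2 l2 m2 \<le> dual_value Nobs \<gamma> a ?l ?m"
    by (simp add: dv algebra_simps)
qed

lemma P_convex:
  assumes N: "(\<Sum>i\<in>UNIV. Nobs i) = N" and "convex D" and h: "\<And>i. concave_on D (\<lambda>x. h x (\<xi> i))"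
  shows "convex_maximization_problem (P_feasible D h \<xi>) (P_objective h \<xi> Nobs N \<gamma>)"
proof -
  let ?S = "P_feasible D h \<xi>" and ?f = "P_objective h \<xi> Nobs N \<gamma>"
  have conc: "u * h x (\<xi> i) + v * h y (\<xi> i) \<le> h (u *\<^sub>R x + v *\<^sub>R y) (\<xi> i)"
    if "x \<in> D" "y \<in> D" "0 \<le> u" "0 \<le> v" "u + v = 1" for x y u v i
    using h[of i] that by (auto simp: concave_on_iff)
  have conv: "convex ?S"
  proof (rule convexI, clarify)
    fix x l m x' l' m' and u v :: real
    assume z: "(x, l, m) \<in> ?S" "(x', l', m') \<in> ?S" and uv: "0 \<le> u" "0 \<le> v" "u + v = 1"
    have "u * m + v * m' \<le> h (u *\<^sub>R x + v *\<^sub>R x') (\<xi> i)" for i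
    proof -
      have "u * m + v * m' \<le> u * h x (\<xi> i) + v * h x' (\<xi> i)"
        using z uv by (intro add_mono mult_left_mono) (auto simp: P_feasible_def)
      also have "\<dots> \<le> h (u *\<^sub>R x + v *\<^sub>R x') (\<xi> i)"
        using z uv by (intro conc) (auto simp: P_feasible_def)
      finally show ?thesis .
    qed
    then show "u *\<^sub>R (x, l, m) + v *\<^sub>R (x', l', m') \<in> ?S"
      using z uv \<open>convex D\<close> by (auto simp: P_feasible_def convexD)
  qed
  have fin: "?f z \<noteq> \<infinity>" if "z \<in> ?S" for z
    using that by (cases z) (auto simp: P_objective_eq[OF N] simp del: P_objective.simps)
  have "ereal u * ?f z + ereal v * ?f w \<le> ?f (u *\<^sub>R z + v *\<^sub>R w)"
    if z: "z \<in> ?S" and w: "w \<in> ?S" and uv: "0 \<le> u" "0 \<le> v" "u + v = 1" for z w u v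
  \<comment> \<open>A zero weight turns -\<infinity> into 0, so only positive weights let an
    infinite value dominate the mixture.\<close>
  proof (cases "u = 0 \<or> v = 0")
    case True
    then show ?thesis using uv by (auto simp: zero_ereal_def[symmetric] one_ereal_def[symmetric])
  next
    case False
    then have uv0: "0 < u" "0 < v" using uv by auto
    obtain x l m where zx: "z = (x, l, m)" by (cases z)
    obtain x' l' m' where wx: "w = (x', l', m')" by (cases w)
    let ?a = "\<lambda>i. h x (\<xi> i)" and ?b = "\<lambda>i. h x' (\<xi> i)" and ?c = "\<lambda>i. h (u *\<^sub>R x + v *\<^sub>R x') (\<xi> i)"
    have mix: "u *\<^sub>R z + v *\<^sub>R w = (u *\<^sub>R x + v *\<^sub>R x', u * l + v * l', u * m + v * m')"
      by (simp add: zx wx)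
    have mixS: "(u *\<^sub>R x + v *\<^sub>R x', u * l + v * l', u * m + v * m') \<in> ?S"
      using convexD[OF conv z w uv] by (simp add: mix)
    show ?thesis
    proof (cases "dual_finite Nobs ?a l m \<and> dual_finite Nobs ?b l' m'")
      case True
      have c: "u * ?a i + v * ?b i \<le> ?c i" for i
        using z w uv by (intro conc) (auto simp: P_feasible_def zx wx)
      have "dual_finite Nobs ?c (u * l + v * l') (u * m + v * m')"
        "u * dual_value Nobs \<gamma> ?a l m + v * dual_value Nobs \<gamma> ?b l' m'
          \<le> dual_value Nobs \<gamma> ?c (u * l + v * l') (u * m + v * m')"
        using dual_value_concave[of Nobs ?a l m ?b l' m' u v ?c] True uv0 c by auto
      then show ?thesis unfolding mix
        using True z w mixS by (simp add: zx wx P_objective_eq[OF N] del: P_objective.simps)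
    next
      case False
      then have "?f z = - \<infinity> \<or> ?f w = - \<infinity>"
        using z w by (auto simp: zx wx P_objective_eq[OF N] simp del: P_objective.simps)
      moreover have "ereal u * ?f z \<noteq> \<infinity>" "ereal v * ?f w \<noteq> \<infinity>"
        using fin[OF z] fin[OF w] uv0 by (auto simp: ereal_mult_eq_PInfty)
      moreover have "ereal u * - \<infinity> = - \<infinity>" "ereal v * - \<infinity> = - \<infinity>" using uv0 by auto
      ultimately have "ereal u * ?f z + ereal v * ?f w = - \<infinity>" by auto
      then show ?thesis by (simp only: ereal_less_eq(2))
    qed
  qed
  then show ?thesis using conv fin by (auto simp: convex_maximization_problem_def)
qed

section \<open>Passage to (LRO) and (P)\<close>

lemma worst_case_distribution_iff:
  "worst_case_distribution h \<xi> Nobs \<gamma> x p \<longleftrightarrow>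
     p \<in> likelihood_robust_set Nobs \<gamma> \<and>
     (\<forall>q\<in>likelihood_robust_set Nobs \<gamma>. expected_value h \<xi> x p \<le> expected_value h \<xi> x q)"
  by (auto simp: worst_case_distribution_def is_arg_min_linorder)

lemma lro_objective_eq:
  assumes "worst_case_distribution h \<xi> Nobs \<gamma> x p"
  shows "lro_objective h \<xi> Nobs \<gamma> x = expected_value h \<xi> x p"
  using assms unfolding lro_objective_def worst_case_distribution_iff
  by (intro cInf_eq_minimum) auto

lemma P_objective_le_expected_value:
  assumes N: "(\<Sum>i\<in>UNIV. Nobs i) = N" and z: "(x, l, m) \<in> P_feasible D h \<xi>"
    and q: "q \<in> likelihood_robust_set Nobs \<gamma>"
  shows "P_objective h \<xi> Nobs N \<gamma> (x, l, m) \<le> ereal (expected_value h \<xi> x q)"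
  using dual_value_le_sum(1)[OF _ q]
  by (simp add: P_objective_eq[OF N z] expected_value_def del: P_objective.simps)

text \<open>Dual values approaching the value of \<open>p\<close> from below are, by weak duality,
  lower bounds for every competitor \<open>q\<close>.\<close>

lemma worst_case_distribution_of_dual_approx:
  assumes p: "p \<in> likelihood_robust_set Nobs \<gamma>"
    and dual: "\<And>e. 0 < e \<Longrightarrow> \<exists>l m. dual_finite Nobs (\<lambda>i. h x (\<xi> i)) l m \<and>
      expected_value h \<xi> x p - e < dual_value Nobs \<gamma> (\<lambda>i. h x (\<xi> i)) l m"
  shows "worst_case_distribution h \<xi> Nobs \<gamma> x p"
  unfolding worst_case_distribution_iff
proof (intro conjI ballI p)
  fix q assume q: "q \<in> likelihood_robust_set Nobs \<gamma>"
  show "expected_value h \<xi> x p \<le> expected_value h \<xi> x q"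
  proof (rule field_le_epsilon)
    fix e :: real assume "0 < e"
    then obtain l m where lm: "dual_finite Nobs (\<lambda>i. h x (\<xi> i)) l m"
      "expected_value h \<xi> x p - e < dual_value Nobs \<gamma> (\<lambda>i. h x (\<xi> i)) l m"
      using dual by blast
    then show "expected_value h \<xi> x p \<le> expected_value h \<xi> x q + e"
      using dual_value_le_sum(1)[OF lm(1) q] by (simp add: expected_value_def)
  qed
qed

lemma dual_finite_feasible:
  assumes "x \<in> D" "dual_finite Nobs (\<lambda>i. h x (\<xi> i)) l m"
  shows "(x, l, m) \<in> P_feasible D h \<xi>"
  using assms by (auto simp: dual_finite_def P_feasible_def)

text \<open>The formula divides by a slack, and \<open>x / 0 = 0\<close> would be meaningless there.
  It is therefore a full distribution when all slacks are nonzero, and in general it fixes the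
  coordinates with nonzero slack. The converse direction asks for a point strictly above
  \<open>\<gamma>\<close> because (P) may lack a maximiser at maximal likelihood.\<close>

theorem proposition1:
  fixes D :: "'a::real_vector set"
    and \<xi> :: "'n::finite \<Rightarrow> 'b"
    and h :: "'a \<Rightarrow> 'b \<Rightarrow> real"
    and Nobs :: "'n \<Rightarrow> nat"
    and N :: nat
    and \<gamma> :: real
  assumes "(\<Sum>i\<in>UNIV. Nobs i) = N"
    and "likelihood_robust_set Nobs \<gamma> \<noteq> {}"
    and "convex D"
    and "\<And>i. concave_on D (\<lambda>x. h x (\<xi> i))"
  shows
    \<comment> \<open>the inner minimum is attained, and it is the supremum of (P) over the dual variables\<close>
    "(\<forall>x\<in>D. (\<exists>p. worst_case_distribution h \<xi> Nobs \<gamma> x p) \<and>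
        ereal (lro_objective h \<xi> Nobs \<gamma> x) =
          (SUP z \<in> {(y, l, m) \<in> P_feasible D h \<xi>. y = x}. P_objective h \<xi> Nobs N \<gamma> z)) \<and>
     \<comment> \<open>(LRO) and (P) have the same optimal value\<close>
     (SUP x\<in>D. ereal (lro_objective h \<xi> Nobs \<gamma> x)) =
        (SUP z \<in> P_feasible D h \<xi>. P_objective h \<xi> Nobs N \<gamma> z) \<and>
     \<comment> \<open>solutions of (P) yield solutions of (LRO)\<close>
     (\<forall>x l m. P_optimal D h \<xi> Nobs N \<gamma> (x, l, m) \<longrightarrow>
        lro_optimal D h \<xi> Nobs \<gamma> x \<and>
        P_objective h \<xi> Nobs N \<gamma> (x, l, m) = ereal (lro_objective h \<xi> Nobs \<gamma> x)) \<and>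
     \<comment> \<open>every solution of (LRO) arises in this way, unless gamma is the maximal log-likelihood\<close>
     ((\<exists>p \<in> likelihood_robust_set Nobs \<gamma>. ereal \<gamma> < log_likelihood Nobs p) \<longrightarrow>
        (\<forall>x. lro_optimal D h \<xi> Nobs \<gamma> x \<longrightarrow> (\<exists>l m. P_optimal D h \<xi> Nobs N \<gamma> (x, l, m)))) \<and>
     \<comment> \<open>(P) is a convex optimization problem\<close>
     convex_maximization_problem (P_feasible D h \<xi>) (P_objective h \<xi> Nobs N \<gamma>) \<and>
     \<comment> \<open>the worst-case distribution\<close>
     (\<forall>x l m. P_optimal D h \<xi> Nobs N \<gamma> (x, l, m) \<longrightarrow>
        ((\<forall>i. h x (\<xi> i) - m \<noteq> 0) \<longrightarrow>
           worst_case_distribution h \<xi> Nobs \<gamma> x (\<chi> i. l * real (Nobs i) / (h x (\<xi> i) - m))) \<and>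
        (\<forall>p. worst_case_distribution h \<xi> Nobs \<gamma> x p \<longrightarrow>
           (\<forall>i. h x (\<xi> i) - m \<noteq> 0 \<longrightarrow> p $ i = l * real (Nobs i) / (h x (\<xi> i) - m))))"
proof -
  let ?L = "likelihood_robust_set Nobs \<gamma>" and ?F = "P_feasible D h \<xi>"
    and ?f = "P_objective h \<xi> Nobs N \<gamma>" and ?g = "lro_objective h \<xi> Nobs \<gamma>"
    and ?wc = "worst_case_distribution h \<xi> Nobs \<gamma>"
  note [simp del] = P_objective.simps
  note N = assms(1)
  have strong: "\<exists>p. ?wc x p \<and> (\<forall>e>0. \<exists>l m. dual_finite Nobs (\<lambda>i. h x (\<xi> i)) l m \<and>
      expected_value h \<xi> x p - e < dual_value Nobs \<gamma> (\<lambda>i. h x (\<xi> i)) l m)" for x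
  proof -
    obtain p where p: "p \<in> ?L" "\<And>e. 0 < e \<Longrightarrow> \<exists>l m. dual_finite Nobs (\<lambda>i. h x (\<xi> i)) l m \<and>
        expected_value h \<xi> x p - e < dual_value Nobs \<gamma> (\<lambda>i. h x (\<xi> i)) l m"
      using strong_duality[OF assms(2), of "\<lambda>i. h x (\<xi> i)"] unfolding expected_value_def by blast
    then show ?thesis using worst_case_distribution_of_dual_approx[of p Nobs \<gamma> h x \<xi>] by blast
  qed
  have weak: "?f (x, l, m) \<le> ereal (?g x)" if "(x, l, m) \<in> ?F" for x l m
  proof -
    obtain p where "?wc x p" using strong by blast
    then show ?thesis
      using P_objective_le_expected_value[OF N that]
      by (simp add: lro_objective_eq worst_case_distribution_iff)
  qed
  have sup: "ereal (?g x) = (SUP z \<in> {(y, l, m) \<in> ?F. y = x}. ?f z)" (is "_ = ?S") if "x \<in> D" for x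
  proof (rule antisym)
    obtain p where p: "?wc x p" "\<And>e. 0 < e \<Longrightarrow> \<exists>l m. dual_finite Nobs (\<lambda>i. h x (\<xi> i)) l m \<and>
        expected_value h \<xi> x p - e < dual_value Nobs \<gamma> (\<lambda>i. h x (\<xi> i)) l m"
      using strong by blast
    show "ereal (?g x) \<le> ?S"
    proof (rule ereal_le_epsilon2)
      fix e :: real assume "0 < e"
      then obtain l m where lm: "dual_finite Nobs (\<lambda>i. h x (\<xi> i)) l m"
        "expected_value h \<xi> x p - e < dual_value Nobs \<gamma> (\<lambda>i. h x (\<xi> i)) l m"
        using p(2) by blast
      have F: "(x, l, m) \<in> ?F" by (rule dual_finite_feasible) fact+
      have "ereal (?g x - e) \<le> ?f (x, l, m)"
        using lm by (simp add: P_objective_eq[OF N F] lro_objective_eq[OF p(1)])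
      also have "\<dots> \<le> ?S" using F by (intro SUP_upper) auto
      finally have "ereal (?g x - e) + ereal e \<le> ?S + ereal e" by (rule add_right_mono)
      then show "ereal (?g x) \<le> ?S + ereal e" by simp
    qed
    show "?S \<le> ereal (?g x)" by (rule SUP_least) (use weak in auto)
  qed
  \<comment> \<open>An optimal triple dominates all feasible ones, hence also the supremum over the
    dual variables at any \<open>y\<close>.\<close>
  have opt_le: "ereal (?g y) \<le> ?f (x, l, m)" if opt: "P_optimal D h \<xi> Nobs N \<gamma> (x, l, m)" and "y \<in> D" for x l m y
  proof -
    have "?f z \<le> ?f (x, l, m)" if "z \<in> ?F" for z
      using opt that by (cases z) (auto simp: P_optimal_def is_arg_max_linorder)
    then show ?thesis unfolding sup[OF \<open>y \<in> D\<close>] by (intro SUP_least) auto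
  qed
  have optF: "(x, l, m) \<in> ?F" "x \<in> D" if "P_optimal D h \<xi> Nobs N \<gamma> (x, l, m)" for x l m
    using that by (auto simp: P_optimal_def is_arg_max_linorder P_feasible_def)
  have opt_eq: "?f (x, l, m) = ereal (?g x)" if "P_optimal D h \<xi> Nobs N \<gamma> (x, l, m)" for x l m
    using opt_le[OF that optF(2)[OF that]] weak[OF optF(1)[OF that]] by (rule antisym[rotated])
  have opt_lro: "lro_optimal D h \<xi> Nobs \<gamma> x" if "P_optimal D h \<xi> Nobs N \<gamma> (x, l, m)" for x l m
    using opt_le[OF that] opt_eq[OF that] optF(2)[OF that]
    by (auto simp: lro_optimal_def is_arg_max_linorder)
  have value_eq: "(SUP x\<in>D. ereal (?g x)) = (SUP z\<in>?F. ?f z)"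
  proof (rule antisym)
    show "(SUP x\<in>D. ereal (?g x)) \<le> (SUP z\<in>?F. ?f z)"
      by (rule SUP_least) (auto simp: sup intro!: SUP_least SUP_upper)
    show "(SUP z\<in>?F. ?f z) \<le> (SUP x\<in>D. ereal (?g x))"
    proof (rule SUP_least, clarify)
      fix x l m assume F: "(x, l, m) \<in> ?F"
      then have "x \<in> D" by (auto simp: P_feasible_def)
      then have "ereal (?g x) \<le> (SUP x\<in>D. ereal (?g x))" by (intro SUP_upper)
      with weak[OF F] show "?f (x, l, m) \<le> (SUP x\<in>D. ereal (?g x))" by (rule order_trans)
    qed
  qed
  have lro_opt: "\<exists>l m. P_optimal D h \<xi> Nobs N \<gamma> (x, l, m)"
    if slater: "\<exists>p\<in>?L. ereal \<gamma> < log_likelihood Nobs p" and opt: "lro_optimal D h \<xi> Nobs \<gamma> x" for x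
  proof -
    have x: "x \<in> D" "\<And>y. y \<in> D \<Longrightarrow> ?g y \<le> ?g x"
      using opt by (auto simp: lro_optimal_def is_arg_max_linorder)
    obtain l m p where lm: "p \<in> ?L" "dual_finite Nobs (\<lambda>i. h x (\<xi> i)) l m"
      "dual_value Nobs \<gamma> (\<lambda>i. h x (\<xi> i)) l m = expected_value h \<xi> x p"
      using dual_attained_slater[of _ Nobs \<gamma> "\<lambda>i. h x (\<xi> i)"] slater unfolding expected_value_def by blast
    have "?wc x p"
    proof (rule worst_case_distribution_of_dual_approx[OF lm(1)])
      fix e :: real assume "0 < e"
      then show "\<exists>l m. dual_finite Nobs (\<lambda>i. h x (\<xi> i)) l m \<and>
          expected_value h \<xi> x p - e < dual_value Nobs \<gamma> (\<lambda>i. h x (\<xi> i)) l m"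
        using lm by (intro exI[of _ l] exI[of _ m]) simp
    qed
    then have g: "?g x = expected_value h \<xi> x p" by (rule lro_objective_eq)
    have F: "(x, l, m) \<in> ?F" by (rule dual_finite_feasible) fact+
    have f: "?f (x, l, m) = ereal (?g x)" using lm by (simp add: P_objective_eq[OF N F] g)
    have "?f (y, l', m') \<le> ?f (x, l, m)" if F': "(y, l', m') \<in> ?F" for y l' m'
    proof -
      have "y \<in> D" using F' by (simp add: P_feasible_def)
      then show ?thesis using weak[OF F'] x(2)[of y] unfolding f by (meson ereal_less_eq(3) order_trans)
    qed
    then have "P_optimal D h \<xi> Nobs N \<gamma> (x, l, m)"
      using F by (auto simp: P_optimal_def is_arg_max_linorder)
    then show ?thesis by blast
  qed
  have wc: "p $ i = l * real (Nobs i) / (h x (\<xi> i) - m)"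
    if opt: "P_optimal D h \<xi> Nobs N \<gamma> (x, l, m)" and p: "?wc x p" and i: "h x (\<xi> i) - m \<noteq> 0" for x l m p i
  proof -
    \<comment> \<open>Optimality closes the gap for every worst-case \<open>p\<close>, so the
      equality case of weak duality applies.\<close>
    have "?f (x, l, m) = ereal (expected_value h \<xi> x p)"
      using opt_eq[OF opt] lro_objective_eq[OF p] by simp
    then have fin: "dual_finite Nobs (\<lambda>i. h x (\<xi> i)) l m"
      "dual_value Nobs \<gamma> (\<lambda>i. h x (\<xi> i)) l m = (\<Sum>i\<in>UNIV. p $ i * h x (\<xi> i))"
      by (auto simp: P_objective_eq[OF N optF(1)[OF opt]] expected_value_def split: if_splits)
    have "p \<in> ?L" using p by (simp add: worst_case_distribution_iff)
    from dual_value_le_sum(2)[OF fin(1) this fin(2)] i show ?thesis by (simp add: eq_divide_eq)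
  qed
  have wc_all: "?wc x (\<chi> i. l * real (Nobs i) / (h x (\<xi> i) - m))"
    if opt: "P_optimal D h \<xi> Nobs N \<gamma> (x, l, m)" and i: "\<forall>i. h x (\<xi> i) - m \<noteq> 0" for x l m
  proof -
    \<comment> \<open>A worst-case distribution exists and all its coordinates are forced, so the
      formula inherits feasibility and minimality from it.\<close>
    obtain p where p: "?wc x p" using strong by blast
    have "p = (\<chi> i. l * real (Nobs i) / (h x (\<xi> i) - m))"
      unfolding vec_eq_iff using wc[OF opt p] i by simp
    with p show ?thesis by simp
  qed
  have convex: "convex_maximization_problem ?F ?f"
    by (rule P_convex) fact+
  show ?thesis
  proof (intro conjI ballI allI impI)
    show "\<exists>p. ?wc x p" for x using strong by blast
  qed (rule sup value_eq opt_lro opt_eq lro_opt convex wc_all wc; assumption?)+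
qed

end
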